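(* Let $f=a_dX^d+\cdots+a_1X+a_0\in\mathbb{Z}[X]$ be an irreducible polynomial of degree $d\ge 2$ and height $H$, and let $M$ be the product of all distinct prime divisors of the discriminant of $f$. Then there exists a prime number $$ p\le\begin{cases} H, & \text{if } \gcd(a_0,M)=1 \text{ and } |a_0|>1,\\ 2H(dM)^d, & \text{if } |a_0|=1,\\ 2H(dHM)^d, & \text{if } \gcd(a_0,M)>1,\end{cases} $$ such that $f$ has a simple root modulo $p$.
   Context: The height of $f$ is $H=\max_i|a_i|$. "$f$ has a simple root modulo $p$" means there is an integer $a$ that is a root of multiplicity one of the reduction of $f$ modulo $p$, i.e. $f(a)\equiv 0\pmod p$ and $f'(a)\not\equiv0\pmod p$. *)

theory Defs
  imports
    "HOL-Number_Theory.Cong"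
    "HOL-Computational_Algebra.Polynomial_Factorial"
    "Subresultants.Resultant_Prelim"
begin

definition height :: "int poly \<Rightarrow> int" where
  "height f = Max ((\<lambda>i. \<bar>coeff f i\<bar>) ` {..degree f})"

text \<open>
  The usual \<open>(-1)\<^bsup>d(d-1)/2\<^esup> Res(f, f') / a\<^sub>d\<close>; the integer division is exact, see
  \<open>discriminant_mult_lead_coeff\<close> below.
\<close>

definition discriminant :: "int poly \<Rightarrow> int" where
  "discriminant f =
     (-1) ^ (degree f * (degree f - 1) div 2) * (resultant f (pderiv f) div lead_coeff f)"

lemma lead_coeff_dvd_resultant_pderiv:
  fixes f :: "int poly"
  assumes "degree f > 0"
  shows "lead_coeff f dvd resultant f (pderiv f)"
proof -
  let ?S = "sylvester_mat f (pderiv f)"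
  let ?n = "degree f + degree (pderiv f)"
  have "lead_coeff f dvd ?S $$ (i, 0)" if "i < ?n" for i
  proof (cases "degree f")
    case (Suc k)
    then show ?thesis
      using that
      by (cases "i = k") (auto simp: sylvester_index_mat coeff_pderiv degree_pderiv)
  qed (use assms in simp)
  moreover have "det ?S = (\<Sum>i<?n. ?S $$ (i, 0) * cofactor ?S i 0)"
    using assms by (intro laplace_expansion_column sylvester_carrier_mat) auto
  ultimately show ?thesis
    by (auto simp: resultant_def intro!: dvd_sum)
qed

lemma discriminant_mult_lead_coeff:
  assumes "degree f > 0"
  shows "lead_coeff f * discriminant f =
    (-1) ^ (degree f * (degree f - 1) div 2) * resultant f (pderiv f)"
  using lead_coeff_dvd_resultant_pderiv[OF assms] by (simp add: discriminant_def)

definition has_simple_root_mod :: "int poly \<Rightarrow> nat \<Rightarrow> bool" where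
  "has_simple_root_mod f p \<longleftrightarrow>
     (\<exists>a::int. [poly f a = 0] (mod int p) \<and> \<not> [poly (pderiv f) a = 0] (mod int p))"

end

theory Submission
  imports Defs "Subresultants.Subresultant_Gcd"
begin

text \<open>
  The discriminant lies in the ideal generated by \<open>f\<close> and \<open>f'\<close>, so a root of \<open>f\<close> modulo a prime
  \<open>p\<close> not dividing the discriminant is simple, even if \<open>p\<close> divides the leading coefficient.
  If \<open>\<bar>a\<^sub>0\<bar> > 1\<close> is coprime to \<open>M\<close>, any prime divisor of \<open>a\<^sub>0 = f(0)\<close> will do. Otherwise consider
  \<open>f(a\<^sub>0 M k) = a\<^sub>0 (1 + M k q(a\<^sub>0 M k))\<close>: the second factor is coprime to \<open>M\<close>, and since
  \<open>f\<close> takes each of the values \<open>\<plusminus>a\<^sub>0\<close> at most \<open>d\<close> times, it differs from \<open>\<plusminus>1\<close> for some \<open>\<bar>k\<bar> \<le> d\<close>.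
\<close>

section \<open>Determinants and the Sylvester matrix of \<open>f\<close> and
  \<open>f'\<close>\<close>

text \<open>Cramer's rule: multiplying \<open>A *\<^sub>v v\<close> by the adjugate gives
  \<open>det A \<cdot>\<^sub>v v\<close>, and the adjugate has entries in the ring.\<close>

lemma dvd_det_mult_vec_index:
  fixes A :: "'a :: comm_ring_1 mat"
  assumes A: "A \<in> carrier_mat n n" and v: "v \<in> carrier_vec n"
    and dvd: "\<And>i. i < n \<Longrightarrow> p dvd (A *\<^sub>v v) $ i" and j: "j < n"
  shows "p dvd det A * v $ j"
proof -
  note adj = adj_mat[OF A]
  have "adj_mat A *\<^sub>v (A *\<^sub>v v) = (adj_mat A * A) *\<^sub>v v"
    using assoc_mult_mat_vec[OF adj(1) A v] by simp
  also have "\<dots> = det A \<cdot>\<^sub>v v"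
    unfolding adj(3) using v by (intro eq_vecI) auto
  finally have "det A * v $ j = (adj_mat A *\<^sub>v (A *\<^sub>v v)) $ j"
    using j v by simp
  also have "\<dots> = (\<Sum>i<n. adj_mat A $$ (j, i) * (A *\<^sub>v v) $ i)"
    using adj(1) A j by (auto simp: scalar_prod_def lessThan_atLeast0)
  finally show ?thesis
    using dvd by (auto intro!: dvd_sum)
qed

lemma poly_eq_sum_lessThan:
  fixes r :: "'a :: comm_semiring_1 poly"
  assumes "degree r < n"
  shows "poly r a = (\<Sum>k<n. coeff r k * a ^ k)"
proof -
  have "(\<Sum>k<n. coeff r k * a ^ k) = (\<Sum>k\<le>degree r. coeff r k * a ^ k)"
    using assms by (intro sum.mono_neutral_right) (auto simp: coeff_eq_0)
  then show ?thesis
    by (simp add: poly_altdef)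
qed

text \<open>Each row lists the coefficients, highest first, of a monomial times \<open>f\<close> or
  \<open>g\<close>; pairing it with the powers of \<open>a\<close> evaluates that product at
  \<open>a\<close>.\<close>

lemma sylvester_mat_mult_powers:
  fixes f g :: "'a :: comm_ring_1 poly" and a :: 'a
  defines "n \<equiv> degree f + degree g"
  assumes i: "i < n"
  shows "(\<Sum>j<n. sylvester_mat f g $$ (i, j) * a ^ (n - Suc j)) =
    (if i < degree g then a ^ (degree g - Suc i) * poly f a else a ^ (n - Suc i) * poly g a)"
proof -
  define r where
    "r = (if i < degree g then monom 1 (degree g - Suc i) * f else monom 1 (n - Suc i) * g)"
  have "degree (monom 1 l * h) \<le> l + degree h" for l and h :: "'a poly"
    by (meson add_right_mono degree_monom_le degree_mult_le order_trans)
  then have "degree r \<le> (if i < degree g then degree g - Suc i + degree f else n - Suc i + degree g)"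
    by (cases "i < degree g") (simp_all only: r_def if_True if_False)
  then have deg: "degree r < n"
    using i unfolding n_def by (auto split: if_splits)
  have "sylvester_mat f g $$ (i, j) = coeff r (n - Suc j)" if j: "j < n" for j
  proof -
    have "sylvester_mat f g $$ (i, j) =
        coeff (if i < degree g then monom 1 (degree g - i) * f else monom 1 (n - i) * g) (n - j)"
      using sylvester_index_mat2[of i f g j] i j by (simp add: n_def)
    \<comment> \<open>Lowering the monomial exponent and the coefficient index together by one
      changes nothing; the last column now holds the constant term.\<close>
    also have "\<dots> = coeff r (n - Suc j)"
      using i j unfolding r_def by (auto simp: coeff_monom_mult n_def Suc_diff_Suc)
    finally show ?thesis .
  qed
  then have "(\<Sum>j<n. sylvester_mat f g $$ (i, j) * a ^ (n - Suc j)) =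
      (\<Sum>j<n. coeff r (n - Suc j) * a ^ (n - Suc j))"
    by simp
  also have "\<dots> = poly r a"
    unfolding poly_eq_sum_lessThan[OF deg] by (rule sum.nat_diff_reindex)
  finally show ?thesis
    by (simp add: r_def poly_monom)
qed

text \<open>Cofactors along column 0 do not see that column, so Laplace expansion lets
  \<open>c\<close> be pulled out.\<close>

lemma det_divide_column_0:
  fixes A B :: "'a :: comm_ring_1 mat"
  assumes A: "A \<in> carrier_mat n n" and B: "B \<in> carrier_mat n n" and n: "n > 0"
    and col: "\<And>i. i < n \<Longrightarrow> A $$ (i, 0) = c * B $$ (i, 0)"
    and rest: "\<And>i j. i < n \<Longrightarrow> 0 < j \<Longrightarrow> j < n \<Longrightarrow> A $$ (i, j) = B $$ (i, j)"
  shows "det A = c * det B"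
proof -
  have "mat_delete A i 0 = mat_delete B i 0" if "i < n" for i
    using A B that by (intro eq_matI) (auto simp: mat_delete_def rest)
  then have "cofactor A i 0 = cofactor B i 0" if "i < n" for i
    using that by (simp add: cofactor_def)
  then show ?thesis
    using laplace_expansion_column[OF A n] laplace_expansion_column[OF B n] col
    by (simp add: sum_distrib_left mult.assoc)
qed

text \<open>
  Up to sign, the discriminant is the determinant of the Sylvester matrix with its first column
  divided by the leading coefficient. That matrix maps a vector with last entry \<open>1\<close> to one whose
  entries are multiples of \<open>f(a)\<close> or \<open>f'(a)\<close>.
\<close>

lemma common_divisor_dvd_discriminant:
  fixes f :: "int poly" and p a :: int
  assumes deg: "degree f \<ge> 2" and f: "p dvd poly f a" and f': "p dvd poly (pderiv f) a"
  shows "p dvd discriminant f"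
proof -
  let ?S = "sylvester_mat f (pderiv f)"
  define n where "n = degree f + degree (pderiv f)"
  define c where "c = lead_coeff f"
  define T where "T = mat n n (\<lambda>(i, j). if j = 0 then ?S $$ (i, 0) div c else ?S $$ (i, j))"
  \<comment> \<open>The factor \<open>c\<close> in the first entry undoes the division in
    \<open>T\<close>, so \<open>T *\<^sub>v v\<close> equals the Sylvester matrix applied to the
    powers of \<open>a\<close>.\<close>
  define v where "v = vec n (\<lambda>j. if j = 0 then c * a ^ (n - 1) else a ^ (n - Suc j))"
  have n: "n \<ge> 2" and c: "c \<noteq> 0"
    using deg by (auto simp: n_def c_def)
  have S: "?S \<in> carrier_mat n n" and T: "T \<in> carrier_mat n n" and v: "v \<in> carrier_vec n"
    by (auto simp: n_def T_def v_def)
  \<comment> \<open>The only nonzero entries of column 0 are the leading coefficients of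
    \<open>f\<close> and \<open>f'\<close>, the latter being \<open>degree f * c\<close>.\<close>
  have c_dvd: "c dvd ?S $$ (i, 0)" if "i < n" for i
  proof (cases "degree f")
    case (Suc k)
    then show ?thesis
      using that unfolding c_def n_def
      by (cases "i = k") (auto simp: sylvester_index_mat coeff_pderiv degree_pderiv)
  qed (use deg in simp)
  have "det ?S = c * det T"
    using n c_dvd by (intro det_divide_column_0[OF S T]) (auto simp: T_def)
  then have disc: "discriminant f = (-1) ^ (degree f * (degree f - 1) div 2) * det T"
    using c by (simp add: discriminant_def resultant_def c_def)
  have "p dvd (T *\<^sub>v v) $ i" if i: "i < n" for i
  proof -
    have "(T *\<^sub>v v) $ i = (\<Sum>j<n. T $$ (i, j) * v $ j)"
      using i T v by (auto simp: scalar_prod_def lessThan_atLeast0)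
    also have "\<dots> = (\<Sum>j<n. ?S $$ (i, j) * a ^ (n - Suc j))"
      using i c_dvd[OF i] by (intro sum.cong) (auto simp: T_def v_def)
    also have "p dvd \<dots>"
      using sylvester_mat_mult_powers[of i f "pderiv f" a] i f f' by (auto simp: n_def)
    finally show ?thesis .
  qed
  then have "p dvd det T * v $ (n - 1)"
    using n by (intro dvd_det_mult_vec_index[OF T v]) auto
  then show ?thesis
    using n by (simp add: disc v_def)
qed

section \<open>Consequences of irreducibility\<close>

text \<open>Otherwise \<open>f\<close> and \<open>f'\<close> share a nonconstant factor, which the
  irreducible \<open>f\<close> divides; so \<open>f\<close> divides the nonzero \<open>f'\<close> of
  smaller degree.\<close>

lemma discriminant_irreducible_nonzero:
  fixes f :: "int poly"
  assumes irr: "irreducible f" and deg: "degree f > 0"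
  shows "discriminant f \<noteq> 0"
proof
  assume "discriminant f = 0"
  then have "resultant f (pderiv f) = 0"
    using discriminant_mult_lead_coeff[OF deg] by simp
  then have gcd: "degree (gcd f (pderiv f)) \<noteq> 0"
    by (simp add: resultant_0_gcd)
  then have "\<not> is_unit (gcd f (pderiv f))"
    using dvd_imp_degree_le[of "gcd f (pderiv f)" 1] by auto
  then have "f dvd gcd f (pderiv f)"
    using irreducibleD'[OF irr, of "gcd f (pderiv f)"] by auto
  then have "f dvd pderiv f"
    by simp
  then have "degree f \<le> degree (pderiv f)"
    using deg by (intro dvd_imp_degree_le) (auto simp: pderiv_eq_0_iff)
  then show False
    using deg by (simp add: degree_pderiv)
qed

lemma irreducible_no_int_root:
  fixes f :: "int poly"
  assumes irr: "irreducible f" and deg: "degree f \<ge> 2"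
  shows "poly f a \<noteq> 0"
proof
  assume "poly f a = 0"
  then have dvd: "[:-a, 1:] dvd f"
    by (simp add: poly_eq_0_iff_dvd)
  have "\<not> is_unit [:-a, 1:]"
    by (auto simp: is_unit_pCons_iff poly_dvd_1)
  then have "f dvd [:-a, 1:]"
    using irreducibleD'[OF irr dvd] by auto
  from dvd_imp_degree_le[OF this] show False
    using deg by simp
qed

section \<open>Size and distribution of the values of \<open>f\<close>\<close>

lemma abs_coeff_le_height: "\<bar>coeff f i\<bar> \<le> height f"
proof (cases "i \<le> degree f")
  case True
  then show ?thesis
    unfolding height_def by (intro Max_ge) auto
next
  case False
  have "\<bar>coeff f 0\<bar> \<le> height f"
    unfolding height_def by (intro Max_ge) auto
  then show ?thesis
    using False by (simp add: coeff_eq_0)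
qed

text \<open>Bounding every coefficient by the height leaves a geometric sum, which for
  \<open>B \<ge> 2\<close> is at most twice its last term.\<close>

lemma abs_poly_le_height:
  fixes f :: "int poly" and x B :: int
  assumes x: "\<bar>x\<bar> \<le> B" and B: "B \<ge> 2"
  shows "\<bar>poly f x\<bar> \<le> 2 * height f * B ^ degree f"
proof -
  have H: "height f \<ge> 0"
    using abs_coeff_le_height[of f 0] by simp
  have geometric: "(\<Sum>i\<le>n. B ^ i) \<le> 2 * B ^ n" for n
  proof (induction n)
    case (Suc n)
    have "2 * B ^ n \<le> B * B ^ n"
      using B by (intro mult_right_mono) auto
    then show ?case
      using Suc by simp
  qed simp
  have "\<bar>poly f x\<bar> \<le> (\<Sum>i\<le>degree f. \<bar>coeff f i\<bar> * \<bar>x\<bar> ^ i)"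
    unfolding poly_altdef by (rule order_trans[OF sum_abs]) (simp add: abs_mult power_abs)
  also have "\<dots> \<le> (\<Sum>i\<le>degree f. height f * B ^ i)"
    using x B H by (intro sum_mono mult_mono power_mono abs_coeff_le_height) auto
  also have "\<dots> = height f * (\<Sum>i\<le>degree f. B ^ i)"
    by (simp add: sum_distrib_left)
  also have "\<dots> \<le> height f * (2 * B ^ degree f)"
    using H by (intro mult_left_mono geometric)
  finally show ?thesis
    by simp
qed

text \<open>Pigeonhole: \<open>f - b\<close> and \<open>f + b\<close> have together at most
  \<open>2 * degree f\<close> roots, while \<open>k\<close> has \<open>2 * degree f + 1\<close>
  candidates.\<close>

lemma exists_small_multiple_abs_poly_ne:
  fixes f :: "int poly" and m b :: int
  assumes deg: "degree f > 0" and m: "m \<noteq> 0"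
  obtains k where "\<bar>k\<bar> \<le> int (degree f)" and "\<bar>poly f (m * k)\<bar> \<noteq> \<bar>b\<bar>"
proof -
  let ?R = "\<lambda>c. {x. poly (f - [:c:]) x = 0}"
  let ?K = "{- int (degree f)..int (degree f)}"
  have ne: "f - [:c:] \<noteq> 0" for c
    using deg by auto
  have roots: "card (?R c) \<le> degree f" for c
    using card_poly_roots_bound[OF ne[of c]] degree_diff_le[of f "degree f" "[:c:]"] by simp
  have fin: "finite (?R b \<union> ?R (-b))"
    using ne poly_roots_finite by blast
  have "\<not> (\<lambda>k. m * k) ` ?K \<subseteq> ?R b \<union> ?R (-b)"
  proof
    assume "(\<lambda>k. m * k) ` ?K \<subseteq> ?R b \<union> ?R (-b)"
    then have "card ((\<lambda>k. m * k) ` ?K) \<le> card (?R b \<union> ?R (-b))"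
      by (rule card_mono[OF fin])
    also have "\<dots> \<le> 2 * degree f"
      using card_Un_le[of "?R b" "?R (-b)"] roots[of b] roots[of "-b"] by linarith
    also have "card ((\<lambda>k. m * k) ` ?K) = 2 * degree f + 1"
      using m by (subst card_image) (auto simp: inj_on_def)
    finally show False
      by simp
  qed
  then obtain k where "k \<in> ?K" "m * k \<notin> ?R b \<union> ?R (-b)"
    by blast
  then show ?thesis
    by (intro that[of k]) (auto simp: abs_if split: if_splits)
qed

section \<open>Primes not dividing the discriminant\<close>

lemma prime_dvd_prod_prime_factors_iff:
  fixes x :: int
  assumes "x \<noteq> 0" and "prime p"
  shows "p dvd \<Prod>(prime_factors x) \<longleftrightarrow> p dvd x"
proof
  assume "p dvd \<Prod>(prime_factors x)"
  then obtain q where "q \<in> prime_factors x" "p dvd q"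
    using prime_dvd_prod_iff[of "prime_factors x" p id] assms by auto
  then show "p dvd x"
    using in_prime_factors_imp_dvd dvd_trans by blast
next
  assume "p dvd x"
  then show "p dvd \<Prod>(prime_factors x)"
    using assms by (intro dvd_prodI[of _ _ id, simplified]) (auto simp: in_prime_factors_iff)
qed

text \<open>Any prime divisor of \<open>y\<close> works: it does not divide the discriminant, so it
  cannot divide both \<open>f(x)\<close> and \<open>f'(x)\<close>.\<close>

lemma has_simple_root_mod_prime_divisor:
  fixes f :: "int poly" and y x :: int
  assumes irr: "irreducible f" and deg: "degree f \<ge> 2"
    and y: "\<bar>y\<bar> > 1" and dvd: "y dvd poly f x"
    and cop: "coprime y (\<Prod>(prime_factors (discriminant f)))"
  obtains p :: nat where "prime p" and "has_simple_root_mod f p" and "int p \<le> \<bar>y\<bar>"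
proof -
  obtain q where q: "prime q" "q dvd y"
    using y prime_divisor_exists[of y] by fastforce
  have "\<not> q dvd discriminant f"
    using q cop discriminant_irreducible_nonzero[OF irr] deg
    by (metis coprime_common_divisor not_prime_unit order_less_le_trans pos2
        prime_dvd_prod_prime_factors_iff)
  then have "\<not> q dvd poly (pderiv f) x"
    using common_divisor_dvd_discriminant[OF deg] q dvd dvd_trans by blast
  moreover have "q \<le> \<bar>y\<bar>"
    using q y by (intro zdvd_imp_le) auto
  moreover have "q \<ge> 0"
    using q prime_ge_0_int by blast
  ultimately show ?thesis
    using q dvd dvd_trans
    by (intro that[of "nat q"]) (auto simp: has_simple_root_mod_def cong_0_iff)
qed

theorem theorem4p1:
  fixes f :: "int poly" and d :: nat and H M a0 :: int
  assumes "irreducible f" and "degree f = d" and "d \<ge> 2"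
    and "H = height f"
    and "M = \<Prod>(prime_factors (discriminant f))"
    and "a0 = coeff f 0"
  shows "\<exists>p::nat. prime p \<and> has_simple_root_mod f p \<and>
           (gcd a0 M = 1 \<and> \<bar>a0\<bar> > 1 \<longrightarrow> int p \<le> H) \<and>
           (\<bar>a0\<bar> = 1 \<longrightarrow> int p \<le> 2 * H * (int d * M) ^ d) \<and>
           (gcd a0 M > 1 \<longrightarrow> int p \<le> 2 * H * (int d * H * M) ^ d)"
proof -
  have deg: "degree f \<ge> 2"
    using assms by simp
  have a0: "poly f 0 = a0" "a0 \<noteq> 0"
    using irreducible_no_int_root[OF assms(1) deg, of 0] assms by (auto simp: poly_0_coeff_0)
  have H: "\<bar>a0\<bar> \<le> H"
    using abs_coeff_le_height assms by simp
  have M: "M > 0"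
    unfolding assms by (intro prod_pos) (auto intro: prime_gt_0_int)
  show ?thesis
  proof (cases "gcd a0 M = 1 \<and> \<bar>a0\<bar> > 1")
    case True
    then obtain p where "prime p" "has_simple_root_mod f p" "int p \<le> \<bar>a0\<bar>"
      using has_simple_root_mod_prime_divisor[OF assms(1) deg, of a0 0] a0 assms(5)
      by (auto simp: coprime_iff_gcd_eq_1)
    then show ?thesis
      using True H by (intro exI[of _ p]) auto
  next
    case False
    define m where "m = a0 * M"
    have m: "m \<noteq> 0"
      using a0 M by (simp add: m_def)
    obtain k where k: "\<bar>k\<bar> \<le> int d" "\<bar>poly f (m * k)\<bar> \<noteq> \<bar>a0\<bar>"
      using exists_small_multiple_abs_poly_ne[of f m a0] deg m assms(2) by auto
    obtain q where q: "f = pCons a0 q"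
      using assms(6) by (cases f) auto
    define y where "y = 1 + M * (k * poly q (m * k))"
    have fy: "poly f (m * k) = a0 * y"
      by (simp add: q y_def m_def algebra_simps)
    have "y \<noteq> 0"
      using irreducible_no_int_root[OF assms(1) deg, of "m * k"] fy by auto
    \<comment> \<open>This is what the choice of \<open>k\<close> was for:
      \<open>\<bar>y\<bar> = 1\<close> would give
      \<open>\<bar>f(m * k)\<bar> = \<bar>a0\<bar>\<close>.\<close>
    moreover have "\<bar>y\<bar> \<noteq> 1"
      using k(2) fy by (auto simp: abs_mult)
    ultimately have "\<bar>y\<bar> > 1"
      by linarith
    moreover have "coprime y M"
      unfolding y_def by (rule coprimeI) (metis dvd_add_left_iff dvd_mult2)
    ultimately obtain p where p: "prime p" "has_simple_root_mod f p" "int p \<le> \<bar>y\<bar>"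
      using has_simple_root_mod_prime_divisor[OF assms(1) deg, of y "m * k"] fy assms(5) by auto
    \<comment> \<open>\<open>\<bar>k\<bar> \<le> d\<close> gives
      \<open>\<bar>m * k\<bar> \<le> ?B\<close>. This serves both remaining cases: \<open>?B\<close>
      is \<open>d * M\<close> if \<open>\<bar>a0\<bar> = 1\<close>, and at most
      \<open>d * H * M\<close> in general.\<close>
    let ?B = "int d * \<bar>a0\<bar> * M"
    have "1 * \<bar>y\<bar> \<le> \<bar>a0\<bar> * \<bar>y\<bar>"
      using a0(2) by (intro mult_right_mono) auto
    then have "int p \<le> \<bar>poly f (m * k)\<bar>"
      using p(3) by (simp add: fy abs_mult)
    also have "\<dots> \<le> 2 * H * ?B ^ d"
    proof -
      have "\<bar>m * k\<bar> \<le> ?B"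
        using mult_left_mono[OF k(1), of "\<bar>a0\<bar> * M"] M by (simp add: m_def abs_mult ac_simps)
      moreover have "2 * 1 * 1 \<le> ?B"
        using assms(3) a0(2) M by (intro mult_mono) auto
      ultimately show ?thesis
        using abs_poly_le_height[of "m * k" ?B f] assms by simp
    qed
    finally have bound: "int p \<le> 2 * H * ?B ^ d" .
    have "2 * H * ?B ^ d \<le> 2 * H * (int d * H * M) ^ d"
      using H M by (intro mult_left_mono power_mono mult_right_mono) auto
    then show ?thesis
      using p bound False by (intro exI[of _ p]) auto
  qed
qed

end
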